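(* Let $\mathcal{A}$ be a complex Banach algebra with identity $1$, let $a,b,c\in\mathcal{A}$, and let $M=\begin{pmatrix} a & b\\ c & 0\end{pmatrix}\in M_2(\mathcal{A})$. If $a^2=a$ and $ab=b$, then the following are equivalent: (1) $M\in M_2(\mathcal{A})^d$, i.e. $M$ has a g-Drazin inverse in $M_2(\mathcal{A})$; (2) $bc\in\mathcal{A}^d$, i.e. $bc$ has a g-Drazin inverse in $\mathcal{A}$.
   Context: $M_2(\mathcal{A})$ is the algebra of $2\times 2$ matrices over $\mathcal{A}$, regarded as a Banach algebra in the usual way (with any of the standard equivalent norms). An element $w$ of a Banach algebra $\mathcal{B}$ is quasinilpotent if $\lim_{n\to\infty}\|w^n\|^{1/n}=0$; $\mathcal{B}^{qnil}$ denotes the set of quasinilpotent elements of $\mathcal{B}$. An element $x\in\mathcal{B}$ has a g-Drazin inverse (generalized Drazin inverse) if there exists $y\in\mathcal{B}$ such that $xy=yx$, $y=yxy$ and $x-x^2y\in\mathcal{B}^{qnil}$; such $y$ is unique if it exists and is denoted $x^d$. $\mathcal{B}^d$ denotes the set of all elements of $\mathcal{B}$ having a g-Drazin inverse. *)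

theory Defs
  imports "HOL-Analysis.Analysis"
begin

section \<open>Unital complex Banach algebras\<close>

text \<open>
  Built on \<^class>\<open>monoid_mult\<close> rather than \<^class>\<open>ring_1\<close>, so neither \<open>1 \<noteq> 0\<close> nor
  \<open>norm 1 = 1\<close> is assumed.  The axiom \<open>scaleR_scaleC\<close> makes the real structure inherited
  from \<^class>\<open>real_normed_algebra\<close> the restriction of the complex one.
\<close>

class complex_banach_algebra = real_normed_algebra + monoid_mult + banach +
  fixes scaleC :: "complex \<Rightarrow> 'a \<Rightarrow> 'a" (infixr "*\<^sub>C" 75)
  assumes scaleC_add_right: "z *\<^sub>C (x + y) = z *\<^sub>C x + z *\<^sub>C y"
    and scaleC_add_left: "(z + w) *\<^sub>C x = z *\<^sub>C x + w *\<^sub>C x"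
    and scaleC_scaleC: "z *\<^sub>C w *\<^sub>C x = (z * w) *\<^sub>C x"
    and scaleR_scaleC: "r *\<^sub>R x = complex_of_real r *\<^sub>C x"
    and mult_scaleC_left: "(z *\<^sub>C x) * y = z *\<^sub>C (x * y)"
    and mult_scaleC_right: "x * (z *\<^sub>C y) = z *\<^sub>C (x * y)"
    and norm_scaleC: "norm (z *\<^sub>C x) = cmod z * norm x"


section \<open>Quasinilpotent elements and generalized Drazin inverses\<close>

definition quasinilpotents :: "'a::complex_banach_algebra set" where
  "quasinilpotents = {w. (\<lambda>n. root n (norm (w ^ n))) \<longlonglongrightarrow> 0}"

definition is_gDrazin_inverse :: "'a::complex_banach_algebra \<Rightarrow> 'a \<Rightarrow> bool" where
  "is_gDrazin_inverse x y \<longleftrightarrow>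
     x * y = y * x \<and> y = y * x * y \<and> x - x\<^sup>2 * y \<in> quasinilpotents"

definition gDrazin_invertibles :: "'a::complex_banach_algebra set" where
  "gDrazin_invertibles = {x. \<exists>y. is_gDrazin_inverse x y}"


section \<open>The Banach algebra of two-by-two matrices\<close>

text \<open>
  A copy of the type of library matrices: there the operation \<open>*\<close> and the constant \<open>1\<close>, and
  hence powers, are componentwise.  The linear structure is inherited, and so is the norm,
  which is the Frobenius norm.
\<close>

typedef (overloaded) 'a mat2 = "UNIV :: ('a ^ 2 ^ 2) set"
  morphisms entries of_entries ..

setup_lifting type_definition_mat2

lift_definition mat2 :: "'a::zero \<Rightarrow> 'a \<Rightarrow> 'a \<Rightarrow> 'a \<Rightarrow> 'a mat2"
  is "\<lambda>a b c d. vector [vector [a, b], vector [c, d]]" .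

text \<open>
  Multiplication is by the defining formula of \<^const>\<open>matrix_matrix_mult\<close>, which itself is only
  available over \<^class>\<open>semiring_1\<close>, where \<open>1 \<noteq> 0\<close>.
\<close>

instantiation mat2 :: (complex_banach_algebra) "{real_normed_algebra, monoid_mult}"
begin

lift_definition zero_mat2 :: "'a mat2" is 0 .
lift_definition one_mat2 :: "'a mat2" is "mat 1" .
lift_definition plus_mat2 :: "'a mat2 \<Rightarrow> 'a mat2 \<Rightarrow> 'a mat2" is "(+)" .
lift_definition minus_mat2 :: "'a mat2 \<Rightarrow> 'a mat2 \<Rightarrow> 'a mat2" is "(-)" .
lift_definition uminus_mat2 :: "'a mat2 \<Rightarrow> 'a mat2" is uminus .
lift_definition times_mat2 :: "'a mat2 \<Rightarrow> 'a mat2 \<Rightarrow> 'a mat2"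
  is "\<lambda>A B. \<chi> i j. \<Sum>k\<in>UNIV. A $ i $ k * B $ k $ j" .
lift_definition scaleR_mat2 :: "real \<Rightarrow> 'a mat2 \<Rightarrow> 'a mat2" is "(*\<^sub>R)" .
lift_definition norm_mat2 :: "'a mat2 \<Rightarrow> real" is norm .

definition dist_mat2 :: "'a mat2 \<Rightarrow> 'a mat2 \<Rightarrow> real" where
  "dist_mat2 A B = norm (A - B)"
definition sgn_mat2 :: "'a mat2 \<Rightarrow> 'a mat2" where
  "sgn_mat2 A = inverse (norm A) *\<^sub>R A"
definition uniformity_mat2 :: "('a mat2 \<times> 'a mat2) filter" where
  "uniformity_mat2 = (INF e\<in>{0 <..}. principal {(A, B). dist A B < e})"
definition open_mat2 :: "'a mat2 set \<Rightarrow> bool" where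
  "open_mat2 U \<longleftrightarrow> (\<forall>A\<in>U. eventually (\<lambda>(A', B). A' = A \<longrightarrow> B \<in> U) uniformity)"

instance
proof
  fix A B C :: "'a mat2" and r s :: real
  show "A + B + C = A + (B + C)" by transfer (simp add: add.assoc)
  show "A + B = B + A" by transfer (simp add: add.commute)
  show "0 + A = A" by transfer simp
  show "- A + A = 0" by transfer simp
  show "A - B = A + - B" by transfer simp
  show "r *\<^sub>R (A + B) = r *\<^sub>R A + r *\<^sub>R B" by transfer (simp add: scaleR_add_right)
  show "(r + s) *\<^sub>R A = r *\<^sub>R A + s *\<^sub>R A" by transfer (simp add: scaleR_add_left)
  show "r *\<^sub>R s *\<^sub>R A = (r * s) *\<^sub>R A" by transfer simp
  show "1 *\<^sub>R A = A" by transfer simp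
  show "A * B * C = A * (B * C)"
    by transfer (simp add: vec_eq_iff sum_2 distrib_left distrib_right mult.assoc add_ac)
  show "(A + B) * C = A * C + B * C"
    by transfer (simp add: vec_eq_iff sum_2 distrib_right add_ac)
  show "A * (B + C) = A * B + A * C"
    by transfer (simp add: vec_eq_iff sum_2 distrib_left add_ac)
  show "1 * A = A" by transfer (simp add: vec_eq_iff sum_2 forall_2 mat_def)
  show "A * 1 = A" by transfer (simp add: vec_eq_iff sum_2 forall_2 mat_def)
  show "r *\<^sub>R A * B = r *\<^sub>R (A * B)"
    by transfer (simp add: vec_eq_iff sum_2 scaleR_add_right)
  show "A * r *\<^sub>R B = r *\<^sub>R (A * B)"
    by transfer (simp add: vec_eq_iff sum_2 scaleR_add_right)
  show "dist A B = norm (A - B)" by (rule dist_mat2_def)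
  show "sgn A = inverse (norm A) *\<^sub>R A" by (rule sgn_mat2_def)
  show "(uniformity :: ('a mat2 \<times> 'a mat2) filter)
          = (INF e\<in>{0 <..}. principal {(A, B). dist A B < e})"
    by (rule uniformity_mat2_def)
  show "open U \<longleftrightarrow> (\<forall>A\<in>U. eventually (\<lambda>(A', B). A' = A \<longrightarrow> B \<in> U) uniformity)"
    for U :: "'a mat2 set" by (rule open_mat2_def)
  show "norm A = 0 \<longleftrightarrow> A = 0" by transfer simp
  show "norm (A + B) \<le> norm A + norm B" by transfer (rule norm_triangle_ineq)
  show "norm (r *\<^sub>R A) = \<bar>r\<bar> * norm A" by transfer simp
  show "norm (A * B) \<le> norm A * norm B"
  proof transfer
    fix A B :: "'a ^ 2 ^ 2"
    let ?P = "\<chi> i j. \<Sum>k\<in>UNIV. A $ i $ k * B $ k $ j"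
    have row: "norm (?P $ i) \<le> norm (A $ i) * norm B" for i
    proof -
      have "norm (?P $ i) = norm (\<Sum>k\<in>UNIV. \<chi> j. A $ i $ k * B $ k $ j)"
        by (rule arg_cong [of _ _ norm]) (simp add: vec_eq_iff)
      also have "\<dots> \<le> (\<Sum>k\<in>UNIV. norm (\<chi> j. A $ i $ k * B $ k $ j))"
        by (rule norm_sum)
      also have "\<dots> \<le> (\<Sum>k\<in>UNIV. \<bar>norm (A $ i $ k)\<bar> * \<bar>norm (B $ k)\<bar>)"
      proof (rule sum_mono)
        fix k
        have "norm (\<chi> j. A $ i $ k * B $ k $ j)
                \<le> L2_set (\<lambda>j. norm (A $ i $ k) * norm (B $ k $ j)) UNIV"
          unfolding norm_vec_def by (rule L2_set_mono) (simp_all add: norm_mult_ineq)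
        then show "norm (\<chi> j. A $ i $ k * B $ k $ j)
                     \<le> \<bar>norm (A $ i $ k)\<bar> * \<bar>norm (B $ k)\<bar>"
          by (simp add: norm_vec_def [of "B $ k"] L2_set_right_distrib)
      qed
      also have "\<dots> \<le> norm (A $ i) * norm B"
        unfolding norm_vec_def [of "A $ i"] norm_vec_def [of B] by (rule L2_set_mult_ineq)
      finally show ?thesis .
    qed
    have "norm ?P \<le> L2_set (\<lambda>i. norm (A $ i) * norm B) UNIV"
      unfolding norm_vec_def [of ?P] by (rule L2_set_mono) (use row in auto)
    also have "\<dots> = norm A * norm B"
      by (simp add: norm_vec_def [of A] L2_set_left_distrib)
    finally show "norm ?P \<le> norm A * norm B" .
  qed
qed

end

instance mat2 :: (complex_banach_algebra) banach
proof
  fix X :: "nat \<Rightarrow> 'a mat2"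
  assume "Cauchy X"
  have d: "dist (entries A) (entries B) = dist A B" for A B :: "'a mat2"
    unfolding dist_norm by transfer simp
  have "Cauchy (\<lambda>n. entries (X n))"
    using \<open>Cauchy X\<close> by (simp add: Cauchy_def d)
  then obtain L where "(\<lambda>n. entries (X n)) \<longlonglongrightarrow> L"
    using Cauchy_convergent convergent_def by blast
  then have "X \<longlonglongrightarrow> of_entries L"
    by (simp add: lim_sequentially d [symmetric] of_entries_inverse)
  then show "convergent X"
    by (rule convergentI)
qed

instantiation mat2 :: (complex_banach_algebra) complex_banach_algebra
begin

lift_definition scaleC_mat2 :: "complex \<Rightarrow> 'a mat2 \<Rightarrow> 'a mat2"
  is "\<lambda>z A. \<chi> i j. z *\<^sub>C (A $ i $ j)" .

instance
proof
  fix A B :: "'a mat2" and z w :: complex and r :: real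
  show "z *\<^sub>C (A + B) = z *\<^sub>C A + z *\<^sub>C B"
    by transfer (simp add: vec_eq_iff scaleC_add_right)
  show "(z + w) *\<^sub>C A = z *\<^sub>C A + w *\<^sub>C A"
    by transfer (simp add: vec_eq_iff scaleC_add_left)
  show "z *\<^sub>C w *\<^sub>C A = (z * w) *\<^sub>C A"
    by transfer (simp add: vec_eq_iff scaleC_scaleC)
  show "r *\<^sub>R A = complex_of_real r *\<^sub>C A"
    by transfer (simp add: vec_eq_iff scaleR_scaleC)
  show "(z *\<^sub>C A) * B = z *\<^sub>C (A * B)"
    by transfer (simp add: vec_eq_iff sum_2 mult_scaleC_left scaleC_add_right)
  show "A * (z *\<^sub>C B) = z *\<^sub>C (A * B)"
    by transfer (simp add: vec_eq_iff sum_2 mult_scaleC_right scaleC_add_right)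
  show "norm (z *\<^sub>C A) = cmod z * norm A"
    by transfer (simp add: norm_vec_def norm_scaleC L2_set_right_distrib)
qed

end

end

(*
  Write t = b c a. Cline's formula (x y is g-Drazin invertible iff y x is) turns M into
  K = [[a, t], [a, 0]] and turns bc = a(bc) into t. As a is an identity for t, K^2 - K = diag(t, t).
  If t has a g-Drazin inverse, then so has K^2 - K, hence K: its spectral idempotent at 0 reduces
  this to the case of quasinilpotent K^2 - K, where an idempotent is lifted by the binomial
  series (1 + 4 q)^(-1/2).
  Conversely, diag(a, a) - K = R K R for an involution R, so it is g-Drazin invertible together
  with K; the two commute, and their product is -diag(t, t).
*)
theory Submission
  imports Defs
begin

text \<open>\<open>norm 1 \<le> 1\<close> is not assumed, so the bound may fail at exponent 0; hence
  the successor.\<close>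

lemma norm_power_le_Suc:
  fixes z :: "'a::complex_banach_algebra"
  shows "norm (z ^ Suc n) \<le> norm z ^ Suc n"
proof (induction n)
  case (Suc n)
  have "norm (z ^ Suc (Suc n)) \<le> norm z * norm (z ^ Suc n)"
    using norm_mult_ineq[of z "z ^ Suc n"] by simp
  also have "\<dots> \<le> norm z * norm z ^ Suc n"
    by (rule mult_left_mono[OF Suc]) simp
  finally show ?case by simp
qed simp

section \<open>Quasinilpotent elements\<close>

lemma norm_mult3_ineq:
  fixes x y z :: "'a::real_normed_algebra"
  shows "norm (x * y * z) \<le> norm x * norm y * norm z"
  by (rule order_trans[OF norm_mult_ineq mult_right_mono[OF norm_mult_ineq norm_ge_zero]])

lemma power_mult_distrib_commute:
  fixes x y :: "'a::monoid_mult"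
  assumes "x * y = y * x"
  shows "(x * y) ^ n = x ^ n * y ^ n"
proof (induction n)
  case (Suc n)
  have "y * x ^ n = x ^ n * y"
    using power_commuting_commutes[OF assms] by simp
  then show ?case
    by (metis Suc mult.assoc power_Suc)
qed simp

text \<open>Trades the limit of roots for eventual geometric bounds, which are easy to combine under
  products, sums and series. Eventuality also discards \<open>n = 0\<close>, where
  \<open>root 0\<close> is 0 by convention.\<close>

lemma quasinilpotents_iff:
  "w \<in> quasinilpotents \<longleftrightarrow> (\<forall>e>0. \<forall>\<^sub>F n in sequentially. norm (w ^ n) \<le> e ^ n)"
proof
  assume w: "w \<in> quasinilpotents"
  show "\<forall>e>0. \<forall>\<^sub>F n in sequentially. norm (w ^ n) \<le> e ^ n"
  proof (intro allI impI)
    fix e :: real assume e: "e > 0"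
    have "\<forall>\<^sub>F n in sequentially. root n (norm (w ^ n)) < e"
      using w e by (auto simp: quasinilpotents_def dest: order_tendstoD)
    then show "\<forall>\<^sub>F n in sequentially. norm (w ^ n) \<le> e ^ n"
      using eventually_gt_at_top[of 0]
    proof eventually_elim
      case (elim n)
      then have "root n (norm (w ^ n)) ^ n \<le> e ^ n"
        by (intro power_mono) auto
      with elim show ?case by simp
    qed
  qed
next
  assume w: "\<forall>e>0. \<forall>\<^sub>F n in sequentially. norm (w ^ n) \<le> e ^ n"
  have "(\<lambda>n. root n (norm (w ^ n))) \<longlonglongrightarrow> 0"
  proof (rule order_tendstoI)
    fix e :: real assume "0 < e"
    then have "\<forall>\<^sub>F n in sequentially. norm (w ^ n) \<le> (e / 2) ^ n" using w by simp
    then show "\<forall>\<^sub>F n in sequentially. root n (norm (w ^ n)) < e"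
      using eventually_gt_at_top[of 0]
    proof eventually_elim
      case (elim n)
      then have "root n (norm (w ^ n)) \<le> root n ((e / 2) ^ n)" by simp
      also have "\<dots> = e / 2" using elim \<open>0 < e\<close> by (simp add: real_root_power_cancel)
      finally show ?case using \<open>0 < e\<close> by simp
    qed
  next
    fix e :: real assume "e < 0"
    moreover have "0 \<le> root n (norm (w ^ n))" for n
      by (cases "n = 0") auto
    ultimately show "\<forall>\<^sub>F n in sequentially. e < root n (norm (w ^ n))"
      by (meson always_eventually order_less_le_trans)
  qed
  then show "w \<in> quasinilpotents" by (simp add: quasinilpotents_def)
qed

text \<open>Halving the base absorbs any constant factor, because \<open>C * (1 / 2) ^ n\<close>
  tends to 0.\<close>

lemma eventually_mult_power_le:
  fixes C e :: real
  assumes "e > 0"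
  shows "\<forall>\<^sub>F n in sequentially. C * (e / 2) ^ n \<le> e ^ n"
proof -
  have "(\<lambda>n. C * (1 / 2) ^ n) \<longlonglongrightarrow> C * 0"
    by (intro tendsto_mult_left LIMSEQ_power_zero) auto
  then have "\<forall>\<^sub>F n in sequentially. C * (1 / 2) ^ n < 1"
    by (rule order_tendstoD) auto
  then show ?thesis
  proof eventually_elim
    case (elim n)
    then have "C * (1 / 2) ^ n * e ^ n \<le> 1 * e ^ n"
      using assms by (intro mult_right_mono) auto
    then show ?case by (simp add: power_divide)
  qed
qed

text \<open>Neither a constant factor nor a shift of the exponent by one affects the exponential
  rate of decay. The shift is what reversing the order of a product produces.\<close>

lemma quasinilpotents_bound:
  assumes "w \<in> quasinilpotents"
    and "\<And>n. norm (z ^ Suc n) \<le> C * norm (w ^ n)"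
  shows "z \<in> quasinilpotents"
  unfolding quasinilpotents_iff
proof (intro allI impI)
  fix e :: real assume e: "0 < e"
  have "\<forall>\<^sub>F n in sequentially. norm (w ^ n) \<le> (e / 2) ^ n"
    using assms(1) e by (simp add: quasinilpotents_iff)
  then have "\<forall>\<^sub>F n in sequentially. norm (z ^ Suc n) \<le> e ^ Suc n"
    \<comment> \<open>The target \<open>e ^ Suc n\<close> has one more factor \<open>e\<close> than
      the available bound, hence the division by \<open>e\<close>; the absolute value allows for any
      sign of \<open>C\<close>.\<close>
    using eventually_mult_power_le[OF e, of "\<bar>C\<bar> / e"]
  proof eventually_elim
    case (elim n)
    have "norm (z ^ Suc n) \<le> \<bar>C\<bar> * norm (w ^ n)"
      using assms(2)[of n] mult_right_mono[OF abs_ge_self[of C] norm_ge_zero[of "w ^ n"]]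
      by linarith
    also have "\<dots> \<le> \<bar>C\<bar> * (e / 2) ^ n"
      using elim(1) by (intro mult_left_mono) auto
    also have "\<dots> = e * (\<bar>C\<bar> / e * (e / 2) ^ n)" using e by simp
    also have "\<dots> \<le> e * e ^ n" using elim(2) e by (intro mult_left_mono) auto
    finally show ?case by simp
  qed
  then show "\<forall>\<^sub>F n in sequentially. norm (z ^ n) \<le> e ^ n"
    by (simp only: eventually_sequentially_Suc[of "\<lambda>n. norm (z ^ n) \<le> e ^ n"])
qed

lemma quasinilpotents_mult_commute:
  assumes w: "w \<in> quasinilpotents" and "w * z = z * w"
  shows "w * z \<in> quasinilpotents"
  unfolding quasinilpotents_iff
proof (intro allI impI)
  fix e :: real assume e: "0 < e"
  \<comment> \<open>Adding 1 keeps the divisor positive even if \<open>z = 0\<close>.\<close>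
  let ?K = "norm z + 1"
  have "e / ?K > 0" using e by (simp add: add_nonneg_pos)
  with w have "\<forall>\<^sub>F n in sequentially. norm (w ^ n) \<le> (e / ?K) ^ n"
    unfolding quasinilpotents_iff by blast
  then show "\<forall>\<^sub>F n in sequentially. norm ((w * z) ^ n) \<le> e ^ n"
    using eventually_gt_at_top[of 0]
  proof eventually_elim
    case (elim n)
    then obtain m where n: "n = Suc m" using gr0_implies_Suc by blast
    have "norm ((w * z) ^ n) \<le> norm (w ^ n) * norm (z ^ n)"
      by (simp add: power_mult_distrib_commute[OF assms(2)] norm_mult_ineq)
    also have "\<dots> \<le> (e / ?K) ^ n * ?K ^ n"
    proof (rule mult_mono)
      show "norm (z ^ n) \<le> ?K ^ n"
        unfolding n by (rule order_trans[OF norm_power_le_Suc power_mono]) auto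
    qed (use elim e in \<open>auto simp: zero_le_divide_iff add_nonneg_nonneg\<close>)
    also have "\<dots> = e ^ n"
      using add_nonneg_pos[OF norm_ge_zero[of z] zero_less_one]
      by (simp flip: power_mult_distrib)
    finally show ?case .
  qed
qed

text \<open>\<open>(v * u) ^ Suc n = v * (u * v) ^ n * u\<close>, so the powers of
  \<open>v * u\<close> decay as those of \<open>u * v\<close> do.\<close>

lemma quasinilpotents_mult_swap:
  assumes "u * v \<in> quasinilpotents"
  shows "v * u \<in> quasinilpotents"
proof (rule quasinilpotents_bound[OF assms, where C = "norm v * norm u"])
  fix n
  have "(v * u) ^ Suc n = v * (u * v) ^ n * u"
    by (induction n) (simp_all add: mult.assoc)
  moreover have "norm (v * (u * v) ^ n * u) \<le> norm v * norm ((u * v) ^ n) * norm u"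
    by (rule norm_mult3_ineq)
  ultimately show "norm ((v * u) ^ Suc n) \<le> norm v * norm u * norm ((u * v) ^ n)"
    by (simp add: mult_ac)
qed

lemma quasinilpotents_zero: "(0 :: 'a::complex_banach_algebra) \<in> quasinilpotents"
  unfolding quasinilpotents_iff eventually_sequentially
proof (intro allI impI exI[of _ 1])
  fix e :: real and n :: nat assume "0 < e" "1 \<le> n"
  then show "norm (0 ^ n :: 'a) \<le> e ^ n" by (cases n) auto
qed

lemma quasinilpotents_minus:
  assumes "w \<in> quasinilpotents"
  shows "- w \<in> quasinilpotents"
  using quasinilpotents_mult_commute[OF assms, of "- 1"] by simp

text \<open>All mixed products vanish, so \<open>(u + v) ^ n = u ^ n + v ^ n\<close> for positive
  \<open>n\<close>.\<close>

lemma quasinilpotents_add_orthogonal: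
  assumes u: "u \<in> quasinilpotents" and v: "v \<in> quasinilpotents"
    and uv: "u * v = 0" and vu: "v * u = 0"
  shows "u + v \<in> quasinilpotents"
  unfolding quasinilpotents_iff
proof (intro allI impI)
  fix e :: real assume e: "0 < e"
  have p: "(u + v) ^ Suc n = u ^ Suc n + v ^ Suc n" for n
  proof (induction n)
    case (Suc n)
    have "u * v ^ Suc n = 0" "v * u ^ Suc n = 0"
      using uv vu by (simp_all flip: mult.assoc)
    with Suc show ?case
      by (simp only: power_Suc[of _ "Suc n"] distrib_left distrib_right) simp
  qed simp
  have "\<forall>\<^sub>F n in sequentially. norm (u ^ n) \<le> (e / 2) ^ n"
    "\<forall>\<^sub>F n in sequentially. norm (v ^ n) \<le> (e / 2) ^ n"
    using u v e by (simp_all add: quasinilpotents_iff)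
  then show "\<forall>\<^sub>F n in sequentially. norm ((u + v) ^ n) \<le> e ^ n"
    using eventually_mult_power_le[OF e, of 2] eventually_gt_at_top[of 0]
  proof eventually_elim
    case (elim n)
    then obtain m where "n = Suc m" using gr0_implies_Suc by blast
    then have "norm ((u + v) ^ n) \<le> norm (u ^ n) + norm (v ^ n)"
      by (simp only: p norm_triangle_ineq)
    with elim show ?case by linarith
  qed
qed

section \<open>Generalized Drazin inverses\<close>

lemma gDrazin_invertiblesI:
  assumes "x * y = y * x" "y = y * x * y" "x - x * (x * y) \<in> quasinilpotents"
  shows "x \<in> gDrazin_invertibles"
  using assms unfolding gDrazin_invertibles_def is_gDrazin_inverse_def
  by (auto simp: power2_eq_square mult.assoc)

lemma gDrazin_invertiblesE:
  assumes "x \<in> gDrazin_invertibles"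
  obtains y where "x * y = y * x" "y * (x * y) = y" "x - x * (x * y) \<in> quasinilpotents"
  using assms unfolding gDrazin_invertibles_def is_gDrazin_inverse_def
  by (auto simp: power2_eq_square mult.assoc)

text \<open>Cline's formula: if \<open>d\<close> is the inverse of \<open>x * y\<close>, then
  \<open>y * d * d * x\<close> is that of \<open>y * x\<close>. The remainder of
  \<open>y * x\<close> is \<open>r * x\<close> with \<open>r = y - y * (x * y * d)\<close>, while
  that of \<open>x * y\<close> is \<open>x * r\<close>; reversing the product preserves
  quasinilpotence.\<close>

lemma gDrazin_cline:
  assumes "x * y \<in> gDrazin_invertibles"
  shows "y * x \<in> gDrazin_invertibles"
proof -
  obtain d where d: "x * y * d = d * (x * y)" "d * (x * y * d) = d"
    and q: "x * y - x * y * (x * y * d) \<in> quasinilpotents"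
    using assms by (rule gDrazin_invertiblesE)
  have xyd: "x * (y * (d * z)) = d * (x * (y * z))" for z
    using d(1) by (metis mult.assoc)
  have dxyd: "d * (x * (y * (d * z))) = d * z" for z
    using d(2) by (metis mult.assoc)
  have ddxy: "d * (d * (x * (y * z))) = d * z" for z
    using dxyd xyd by metis
  show ?thesis
  proof (rule gDrazin_invertiblesI[where y = "y * d * d * x"])
    show "y * x * (y * d * d * x) = y * d * d * x * (y * x)"
      by (simp add: mult.assoc xyd)
    show "y * d * d * x = y * d * d * x * (y * x) * (y * d * d * x)"
      by (simp add: mult.assoc xyd ddxy)
    have "x * (y - y * (x * y * d)) \<in> quasinilpotents"
      using q by (simp add: right_diff_distrib mult.assoc)
    then have "(y - y * (x * y * d)) * x \<in> quasinilpotents"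
      by (rule quasinilpotents_mult_swap)
    then show "y * x - y * x * (y * x * (y * d * d * x)) \<in> quasinilpotents"
      by (simp add: left_diff_distrib mult.assoc xyd ddxy)
  qed
qed

lemma gDrazin_minus:
  assumes "x \<in> gDrazin_invertibles"
  shows "- x \<in> gDrazin_invertibles"
proof -
  obtain y where y: "x * y = y * x" "y * (x * y) = y" "x - x * (x * y) \<in> quasinilpotents"
    using assms by (rule gDrazin_invertiblesE)
  show ?thesis
    by (rule gDrazin_invertiblesI[where y = "- y"])
      (use y quasinilpotents_minus[OF y(3)] in \<open>simp_all add: mult.assoc\<close>)
qed

text \<open>Powers of \<open>y\<close> grow at most geometrically and powers of \<open>w\<close>
  decay faster than any geometric sequence, so the bound on the fixed number \<open>norm s\<close>
  tends to 0.\<close>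

lemma quasinilpotent_sandwich_zero:
  fixes s w y :: "'a::complex_banach_algebra"
  assumes w: "w \<in> quasinilpotents"
    and le: "\<And>n. norm s \<le> norm (w ^ Suc n) * C * norm (y ^ Suc n)" and C: "0 \<le> C"
  shows "s = 0"
proof -
  let ?K = "norm y + 1"
  have K: "0 < ?K" by (simp add: add_nonneg_pos)
  \<comment> \<open>The base is chosen to cancel the growth \<open>?K ^ n\<close> of the powers of
    \<open>y\<close> and still leave a factor \<open>(1 / 2) ^ n\<close>.\<close>
  have "\<forall>\<^sub>F n in sequentially. norm (w ^ n) \<le> (inverse ?K / 2) ^ n"
    using w K by (simp add: quasinilpotents_iff)
  then have ev: "\<forall>\<^sub>F n in sequentially. norm s \<le> C * (1/2) ^ n"
    using eventually_gt_at_top[of 0]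
  proof eventually_elim
    case (elim n)
    then obtain m where n: "n = Suc m" using gr0_implies_Suc by blast
    have "norm s \<le> norm (w ^ n) * C * norm (y ^ n)" using le n by blast
    also have "\<dots> \<le> ((inverse ?K / 2) ^ n * C) * ?K ^ n"
    proof (intro mult_mono)
      show "norm (y ^ n) \<le> ?K ^ n"
        unfolding n by (rule order_trans[OF norm_power_le_Suc power_mono]) auto
    qed (use elim C K in auto)
    also have "\<dots> = C * ((inverse ?K * ?K) / 2) ^ n"
      by (simp add: power_mult_distrib power_divide)
    also have "\<dots> = C * (1/2) ^ n" using K by simp
    finally show ?case .
  qed
  have "(\<lambda>n. C * (1 / 2) ^ n) \<longlonglongrightarrow> C * 0"
    by (intro tendsto_mult_left LIMSEQ_power_zero) auto
  from tendsto_lowerbound[OF this ev] show "s = 0" by simp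
qed

text \<open>
  With \<open>f = x y\<close> and \<open>w = x (1 - f)\<close>, the corner \<open>(1 - f) z f\<close> equals \<open>w\<^sup>n (z f) y\<^sup>n\<close> for every
  \<open>n \<ge> 1\<close>, hence vanishes because \<open>w\<close> is quasinilpotent; symmetrically for \<open>f z (1 - f)\<close>.
\<close>

lemma gDrazin_double_commutant:
  assumes y: "x * y = y * x" "y * (x * y) = y" "x - x * (x * y) \<in> quasinilpotents"
    and z: "x * z = z * x"
  shows "y * z = z * y"
proof -
  define f where "f = x * y"
  define w where "w = x - x * f"
  have fx: "f * x = x * f" and fy: "f * y = y" "y * f = y" and ff: "f * f = f"
    using y by (simp_all add: f_def mult.assoc) (metis mult.assoc)+
  have pow: "x ^ n * y ^ n * f = f" for n
  proof (induction n)
    case (Suc n)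
    have "x ^ Suc n * y ^ Suc n * f = x * (x ^ n * y ^ n) * y * f"
      by (simp add: mult.assoc power_Suc2[of y] del: power_Suc) (simp add: mult.assoc)
    also have "\<dots> = x * (x ^ n * y ^ n * f) * y"
      using fy by (simp add: mult.assoc)
    also have "\<dots> = f" using Suc fx fy by (simp add: mult.assoc f_def)
    finally show ?case .
  qed simp
  have pow': "y ^ n * x ^ n * f = f" for n
    using pow power_commuting_commutes[OF power_commuting_commutes[OF y(1), symmetric], symmetric]
    by metis
  have fxn: "f * x ^ n = x ^ n * f" for n
    using power_commuting_commutes[OF fx[symmetric]] by simp
  have xz: "x ^ n * z = z * x ^ n" for n
    by (rule power_commuting_commutes) (rule z)
  have wX: "w * (X - X * f) = x * X - x * X * f" if "f * X = X * f" for X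
  proof -
    have "f * (X * f) = X * f" using that ff by (metis mult.assoc)
    then show ?thesis
      by (simp add: w_def left_diff_distrib right_diff_distrib mult.assoc that)
  qed
  \<comment> \<open>Only positive exponents are allowed: at exponent 0 the power is 1, but the
    right-hand side would be \<open>1 - f\<close>.\<close>
  have wn: "w ^ Suc n = x ^ Suc n - x ^ Suc n * f" for n
  proof (induction n)
    case (Suc n)
    then show ?case using wX[OF fxn[of "Suc n"]] by (simp only: power_Suc[of _ "Suc n"])
  qed (simp add: w_def)
  have wq: "w \<in> quasinilpotents" using y(3) by (simp add: w_def f_def)
  have xf: "x ^ n * (y ^ n * f) = f" "y ^ n * (x ^ n * f) = f" for n
    using pow pow' by (simp_all add: mult.assoc)
  have fyn: "f * y ^ n = y ^ n * f" for n
    using power_commuting_commutes[of y f n] fy by simp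
  have 1: "z * f - f * z * f = 0"
  proof (rule quasinilpotent_sandwich_zero[OF wq, where y = y and C = "norm (z * f)"])
    fix n
    let ?n = "Suc n"
    define X Y where "X = x ^ ?n" and "Y = y ^ ?n"
    have Xz: "X * z = z * X" "X * (z * t) = z * (X * t)" for t
      using xz[of ?n] by (simp_all add: X_def flip: mult.assoc del: power_Suc)
    have Xf: "X * f = f * X" "X * (f * t) = f * (X * t)" for t
      using fxn[of ?n] by (simp_all add: X_def flip: mult.assoc del: power_Suc)
    have "f * (X * Y) = X * (Y * f)"
      using Xf(2)[of Y] fyn[of ?n, folded Y_def] by metis
    then have XY: "f * (X * Y) = f"
      using xf(1)[of ?n] by (simp add: X_def Y_def del: power_Suc)
    have "w ^ ?n * (z * f) * y ^ ?n = (X - X * f) * (z * f) * Y"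
      by (simp only: wn X_def Y_def)
    also have "\<dots> = z * f - f * z * f"
      by (simp add: left_diff_distrib mult.assoc Xz Xf XY)
    finally show "norm (z * f - f * z * f) \<le> norm (w ^ ?n) * norm (z * f) * norm (y ^ ?n)"
      using norm_mult3_ineq[of "w ^ ?n" "z * f" "y ^ ?n"] by (simp only:)
  qed simp
  have 2: "f * z - f * z * f = 0"
  proof (rule quasinilpotent_sandwich_zero[OF wq, where y = y and C = "norm (f * z)"])
    fix n
    let ?n = "Suc n"
    define X Y where "X = x ^ ?n" and "Y = y ^ ?n"
    have zX: "z * X = X * z" "z * (X * t) = X * (z * t)" for t
      using xz[of ?n, symmetric] by (simp_all add: X_def flip: mult.assoc del: power_Suc)
    have fX: "f * X = X * f" "f * (X * t) = X * (f * t)" for t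
      using fxn[of ?n] by (simp_all add: X_def flip: mult.assoc del: power_Suc)
    have YXf: "Y * (X * (f * t)) = f * t" for t
      using xf(2)[of ?n] by (simp add: X_def Y_def flip: mult.assoc del: power_Suc)
    have "y ^ ?n * (f * z) * w ^ ?n = Y * (f * z) * (X - X * f)"
      by (simp only: wn X_def Y_def)
    also have "\<dots> = f * z - f * z * f"
      by (simp add: right_diff_distrib mult.assoc zX fX YXf)
    finally have "norm (f * z - f * z * f) \<le> norm (y ^ ?n) * norm (f * z) * norm (w ^ ?n)"
      using norm_mult3_ineq[of "y ^ ?n" "f * z" "w ^ ?n"] by (simp only:)
    then show "norm (f * z - f * z * f) \<le> norm (w ^ ?n) * norm (f * z) * norm (y ^ ?n)"
      by (simp only: mult_ac)
  qed simp
  have fz: "f * z = z * f" using 1 2 by simp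
  \<comment> \<open>Now \<open>f\<close> commutes with \<open>z\<close>. Inserting
    \<open>f = x * y\<close> next to \<open>y\<close> and moving it past \<open>z\<close> provides a
    factor \<open>x\<close>, which can be moved back past \<open>z\<close>, leaving the other
    \<open>y\<close> on the right.\<close>
  have "y * z = y * (f * z)" using fy by (simp flip: mult.assoc)
  also have "\<dots> = y * (z * x) * y" by (metis fz f_def mult.assoc)
  also have "\<dots> = (y * x) * z * y" by (metis z mult.assoc)
  also have "\<dots> = f * z * y" by (simp add: f_def y(1))
  also have "\<dots> = z * y" using fz fy by (simp add: mult.assoc)
  finally show ?thesis .
qed

text \<open>The double commutant property makes \<open>x\<close>, \<open>z\<close> and their
  inverses \<open>y\<close>, \<open>v\<close> commute pairwise, so \<open>y * v\<close> is the
  candidate inverse. The remainder is the sum of \<open>(x - x * (x * y)) * z\<close> and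
  \<open>(z - z * (z * v)) * (x * (x * y))\<close>, which are quasinilpotent and annihilate each
  other since \<open>x * y\<close> is idempotent.\<close>

lemma gDrazin_mult_commute:
  assumes "x \<in> gDrazin_invertibles" "z \<in> gDrazin_invertibles" and xz: "x * z = z * x"
  shows "x * z \<in> gDrazin_invertibles"
proof -
  obtain y where y: "x * y = y * x" "y * (x * y) = y" "x - x * (x * y) \<in> quasinilpotents"
    using assms(1) by (rule gDrazin_invertiblesE)
  obtain v where v: "z * v = v * z" "v * (z * v) = v" "z - z * (z * v) \<in> quasinilpotents"
    using assms(2) by (rule gDrazin_invertiblesE)
  have yz: "y * z = z * y" by (rule gDrazin_double_commutant[OF y xz])
  have vx: "v * x = x * v" by (rule gDrazin_double_commutant[OF v]) (simp add: xz)
  have yv: "y * v = v * y" by (rule gDrazin_double_commutant[OF y]) (simp add: vx)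
  have c: "z * (x * t) = x * (z * t)" "y * (x * t) = x * (y * t)" "z * (y * t) = y * (z * t)"
    "v * (x * t) = x * (v * t)" "v * (y * t) = y * (v * t)" "v * (z * t) = z * (v * t)" for t
    using xz y(1) yz vx yv v(1) by (metis mult.assoc)+
  note c0 = xz[symmetric] y(1)[symmetric] yz[symmetric] vx yv[symmetric] v(1)[symmetric]
  have yy: "x * (y * y) = y" "x * (y * (y * t)) = y * t" for t
    using y(2) by (simp_all add: c c0 mult.assoc) (metis c mult.assoc)
  have vv: "z * (v * v) = v" "z * (v * (v * t)) = v * t" for t
    using v(2) by (simp_all add: c c0 mult.assoc) (metis c mult.assoc)
  show ?thesis
  proof (rule gDrazin_invertiblesI[where y = "y * v"])
    show "x * z * (y * v) = y * v * (x * z)" by (simp add: mult.assoc c c0)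
    show "y * v = y * v * (x * z) * (y * v)"
      by (simp add: mult.assoc c c0 yy vv)
    let ?u = "(x - x * (x * y)) * z" and ?w = "(z - z * (z * v)) * (x * (x * y))"
    have "?u \<in> quasinilpotents"
      by (rule quasinilpotents_mult_commute[OF y(3)])
        (simp add: mult.assoc c c0 left_diff_distrib right_diff_distrib)
    moreover have "?w \<in> quasinilpotents"
      by (rule quasinilpotents_mult_commute[OF v(3)])
        (simp add: mult.assoc c c0 left_diff_distrib right_diff_distrib)
    moreover have "?u * ?w = 0" "?w * ?u = 0"
      by (simp_all add: mult.assoc c c0 left_diff_distrib right_diff_distrib yy vv)
    ultimately have "?u + ?w \<in> quasinilpotents"
      by (rule quasinilpotents_add_orthogonal)
    moreover have "?u + ?w = x * z - x * z * (x * z * (y * v))"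
      by (simp add: mult.assoc c c0 left_diff_distrib right_diff_distrib yy vv)
    ultimately show "x * z - x * z * (x * z * (y * v)) \<in> quasinilpotents" by simp
  qed
qed

text \<open>Because \<open>y = y * y * x = x * y * y\<close>, and likewise for \<open>v\<close>,
  orthogonality of \<open>x\<close> and \<open>z\<close> passes to their inverses; then inverses and
  remainders simply add up.\<close>

lemma gDrazin_add_orthogonal:
  assumes "x \<in> gDrazin_invertibles" "z \<in> gDrazin_invertibles"
    and xz: "x * z = 0" and zx: "z * x = 0"
  shows "x + z \<in> gDrazin_invertibles"
proof -
  obtain y where y: "x * y = y * x" "y * (x * y) = y" "x - x * (x * y) \<in> quasinilpotents"
    using assms(1) by (rule gDrazin_invertiblesE)
  obtain v where v: "z * v = v * z" "v * (z * v) = v" "z - z * (z * v) \<in> quasinilpotents"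
    using assms(2) by (rule gDrazin_invertiblesE)
  have 0: "x * (z * t) = 0" "z * (x * t) = 0" for t
    using xz zx by (simp_all flip: mult.assoc)
  have yz: "y * z = 0" by (metis 0(1) mult.assoc mult_zero_right xz y)
  have zy: "z * y = 0" by (metis 0(2) mult.assoc y(1,2))
  have vx: "v * x = 0" by (metis mult.assoc mult_zero_right zx v)
  have xv: "x * v = 0" by (metis 0(1) mult.assoc v(1,2))
  have yz0: "y * (z * t) = 0" "z * (y * t) = 0" "v * (x * t) = 0" "x * (v * t) = 0" for t
    using yz zy vx xv by (simp_all flip: mult.assoc)
  show ?thesis
  proof (rule gDrazin_invertiblesI[where y = "y + v"])
    show "(x + z) * (y + v) = (y + v) * (x + z)"
      using y v by (simp add: distrib_left distrib_right yz zy vx xv)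
    show "y + v = (y + v) * (x + z) * (y + v)"
      using y v by (simp add: distrib_left distrib_right yz zy vx xv yz0 mult.assoc)
    have "(x - x * (x * y)) + (z - z * (z * v)) \<in> quasinilpotents"
      by (rule quasinilpotents_add_orthogonal[OF y(3) v(3)])
        (simp_all add: left_diff_distrib right_diff_distrib mult.assoc xz zx yz zy vx xv 0 yz0)
    then show "x + z - (x + z) * ((x + z) * (y + v)) \<in> quasinilpotents"
      by (simp add: distrib_left distrib_right zy xv xz zx 0 algebra_simps)
  qed
qed

section \<open>The binomial series of a quasinilpotent element\<close>

text \<open>Passing from \<open>n\<close> to \<open>Suc n\<close> multiplies by
  \<open>(r - n) / (n + 1)\<close>, of absolute value at most 1.\<close>

lemma norm_gbinomial_le_1:
  fixes r :: real
  assumes "\<bar>r\<bar> \<le> 1"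
  shows "\<bar>r gchoose n\<bar> \<le> 1"
proof (induction n)
  case (Suc n)
  have "r gchoose Suc n = (r gchoose n) * (r - real n) / real (Suc n)"
    by (simp add: gbinomial_prod_rev atLeast0_lessThan_Suc mult_ac)
  moreover have "\<bar>r gchoose n\<bar> * \<bar>r - real n\<bar> \<le> 1 * (real n + 1)"
    using assms Suc by (intro mult_mono) auto
  ultimately show ?case by (simp add: abs_mult divide_le_eq)
qed simp

text \<open>This stands for the power of \<open>1 + w\<close> with real exponent \<open>r\<close>;
  it is used for quasinilpotent \<open>w\<close>, where the series converges absolutely for
  \<open>\<bar>r\<bar> \<le> 1\<close>.\<close>

definition binomial_series :: "real \<Rightarrow> 'a::complex_banach_algebra \<Rightarrow> 'a" where
  "binomial_series r w = (\<Sum>n. (r gchoose n) *\<^sub>R w ^ n)"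

text \<open>General bounded coefficients serve both the binomial series and the series obtained from
  it by removing the constant term and a factor \<open>w\<close>.\<close>

lemma summable_norm_quasinilpotent_series:
  fixes c :: "nat \<Rightarrow> real"
  assumes w: "w \<in> quasinilpotents" and c: "\<And>n. \<bar>c n\<bar> \<le> 1"
  shows "summable (\<lambda>n. norm (c n *\<^sub>R w ^ n))"
proof (rule summable_comparison_test_ev)
  have "\<forall>\<^sub>F n in sequentially. norm (w ^ n) \<le> (1 / 2) ^ n"
    using w by (simp add: quasinilpotents_iff)
  then show "\<forall>\<^sub>F n in sequentially. norm (norm (c n *\<^sub>R w ^ n)) \<le> (1 / 2 :: real) ^ n"
  proof eventually_elim
    case (elim n)
    have "\<bar>c n\<bar> * norm (w ^ n) \<le> 1 * (1 / 2) ^ n"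
      using elim c by (intro mult_mono) auto
    then show ?case by simp
  qed
qed (simp add: summable_geometric)

lemmas summable_quasinilpotent_series =
  summable_norm_cancel[OF summable_norm_quasinilpotent_series]

lemma quasinilpotent_series_commute:
  fixes c :: "nat \<Rightarrow> real"
  assumes "w \<in> quasinilpotents" "\<And>n. \<bar>c n\<bar> \<le> 1" and wz: "w * z = z * w"
  shows "(\<Sum>n. c n *\<^sub>R w ^ n) * z = z * (\<Sum>n. c n *\<^sub>R w ^ n)"
proof -
  have "w ^ n * z = z * w ^ n" for n
    by (rule power_commuting_commutes[OF wz])
  then have eq: "(\<Sum>n. c n *\<^sub>R w ^ n * z) = (\<Sum>n. z * c n *\<^sub>R w ^ n)" by simp
  have sm: "summable (\<lambda>n. c n *\<^sub>R w ^ n)"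
    by (rule summable_quasinilpotent_series[OF assms(1,2)])
  show ?thesis
    using eq unfolding suminf_mult2[OF sm] suminf_mult[OF sm] .
qed

text \<open>Vandermonde's identity evaluates the coefficients of the Cauchy product.\<close>

lemma binomial_series_mult:
  assumes w: "w \<in> quasinilpotents" and "\<bar>r\<bar> \<le> 1" "\<bar>s\<bar> \<le> 1"
  shows "binomial_series r w * binomial_series s w = binomial_series (r + s) w"
proof -
  have "(\<lambda>n. \<Sum>i\<le>n. ((r gchoose i) *\<^sub>R w ^ i) * ((s gchoose (n - i)) *\<^sub>R w ^ (n - i)))
      sums (binomial_series r w * binomial_series s w)"
    unfolding binomial_series_def
    by (intro Cauchy_product_sums summable_norm_quasinilpotent_series norm_gbinomial_le_1 assms)
  also have "(\<lambda>n. \<Sum>i\<le>n. ((r gchoose i) *\<^sub>R w ^ i) * ((s gchoose (n - i)) *\<^sub>R w ^ (n - i)))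
      = (\<lambda>n. ((r + s) gchoose n) *\<^sub>R w ^ n)"
  proof
    fix n
    have "(\<Sum>i\<le>n. ((r gchoose i) *\<^sub>R w ^ i) * ((s gchoose (n - i)) *\<^sub>R w ^ (n - i)))
        = (\<Sum>i\<le>n. ((r gchoose i) * (s gchoose (n - i))) *\<^sub>R w ^ n)"
      by (intro sum.cong refl) (simp add: mult_ac flip: power_add)
    also have "\<dots> = ((r + s) gchoose n) *\<^sub>R w ^ n"
      by (simp add: gbinomial_Vandermonde[symmetric] atLeast0AtMost flip: scaleR_left.sum)
    finally show "(\<Sum>i\<le>n. ((r gchoose i) *\<^sub>R w ^ i) * ((s gchoose (n - i)) *\<^sub>R w ^ (n - i)))
        = ((r + s) gchoose n) *\<^sub>R w ^ n" .
  qed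
  finally show ?thesis unfolding binomial_series_def by (simp add: sums_iff)
qed

lemma binomial_series_0: "binomial_series 0 w = 1"
proof -
  have "(\<lambda>n. (0 gchoose n) *\<^sub>R w ^ n) sums (\<Sum>n\<in>{0}. ((0::real) gchoose n) *\<^sub>R w ^ n)"
    by (rule sums_finite) (auto simp: gbinomial_0_left)
  then show ?thesis by (simp add: binomial_series_def sums_iff)
qed

lemma binomial_series_1: "binomial_series 1 w = 1 + w"
proof -
  have "((1::real) gchoose n) = 0" if "n \<notin> {0, 1}" for n
    using that binomial_gbinomial[of 1 n, where 'a = real] by (simp add: binomial_eq_0)
  then have "(\<lambda>n. (1 gchoose n) *\<^sub>R w ^ n) sums (\<Sum>n\<in>{0, 1}. ((1::real) gchoose n) *\<^sub>R w ^ n)"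
    by (intro sums_finite) auto
  then show ?thesis by (simp add: binomial_series_def sums_iff)
qed

lemma binomial_series_commute:
  assumes "w \<in> quasinilpotents" "\<bar>r\<bar> \<le> 1" "w * z = z * w"
  shows "binomial_series r w * z = z * binomial_series r w"
  unfolding binomial_series_def
  by (rule quasinilpotent_series_commute) (simp_all add: assms norm_gbinomial_le_1)

text \<open>Exhibits the series as 1 plus a multiple of \<open>w\<close>. Calculations with it
  become polynomial identities in commuting elements, in which a factor \<open>w\<close> can be
  split off.\<close>

lemma binomial_series_diff_1:
  assumes w: "w \<in> quasinilpotents" and r: "\<bar>r\<bar> \<le> 1"
  obtains g where "binomial_series r w = 1 + w * g" "\<And>z. w * z = z * w \<Longrightarrow> g * z = z * g"
proof
  let ?f = "\<lambda>n. (r gchoose n) *\<^sub>R w ^ n"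
  let ?g = "\<lambda>n. (r gchoose Suc n) *\<^sub>R w ^ n"
  have sf: "summable ?f" and sg: "summable ?g"
    by (rule summable_quasinilpotent_series[OF w norm_gbinomial_le_1[OF r]])+
  have "binomial_series r w = ?f 0 + (\<Sum>n. ?f (Suc n))"
    unfolding binomial_series_def
    using suminf_split_head[OF sf] by simp
  also have "(\<Sum>n. ?f (Suc n)) = w * suminf ?g"
    by (simp add: suminf_mult[OF sg, symmetric])
  finally show "binomial_series r w = 1 + w * suminf ?g" by simp
  show "suminf ?g * z = z * suminf ?g" if "w * z = z * w" for z
    by (rule quasinilpotent_series_commute[OF w norm_gbinomial_le_1[OF r] that])
qed

section \<open>Lifting g-Drazin invertibility from \<open>x\<^sup>2 - x\<close> to \<open>x\<close>\<close>

lemma double_eqD: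
  fixes u v :: "'a::real_vector"
  assumes "u + u = v + v"
  shows "u = v"
  using assms by (simp flip: scaleR_2)

text \<open>
  With \<open>q = x\<^sup>2 - x\<close> we have \<open>(2 x - 1)\<^sup>2 = 1 + 4 q\<close>, so \<open>m h\<close> below is an involution, where
  \<open>h = (1 + 4 q) powr (- 1 / 2)\<close>.  The idempotent \<open>f = (1 + m h) / 2\<close> splits off the part of \<open>x\<close> with
  spectrum \<open>{1}\<close>.  As \<open>1 \<noteq> 0\<close> is not assumed, there are no numerals in the algebra: multiples are
  written as sums, and identities involving \<open>f\<close> are proved after doubling.
\<close>

lemma gDrazin_if_square_minus_quasinilpotent:
  fixes x :: "'a::complex_banach_algebra"
  assumes "x * x - x \<in> quasinilpotents"
  shows "x \<in> gDrazin_invertibles"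
proof -
  define q where "q = x * x - x"
  define w where "w = q + q + q + q"
  have q: "q \<in> quasinilpotents" using assms by (simp add: q_def)
  have w: "w \<in> quasinilpotents"
    using quasinilpotents_mult_commute[OF q, of "1 + 1 + 1 + 1"]
    by (simp add: w_def distrib_left distrib_right)
  have qx: "x * q = q * x" by (simp add: q_def algebra_simps)
  define h where "h = binomial_series (- 1 / 2) w"
  obtain g where g: "h = 1 + w * g" and gc: "\<And>z. w * z = z * w \<Longrightarrow> g * z = z * g"
    using binomial_series_diff_1[OF w, of "- 1 / 2"] unfolding h_def by auto
  have gx: "g * x = x * g" and gq: "g * q = q * g"
    by (rule gc; simp add: w_def qx distrib_left distrib_right)+
  define m where "m = x + x - 1"
  \<comment> \<open>Chosen so that \<open>x * f - f = q * z\<close>: twice the left side is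
    \<open>(x - 1) * (1 + m) + (x - 1) * m * w * g\<close>, where \<open>1 + m = x + x\<close>,
    \<open>(x - 1) * x = q\<close> and \<open>w\<close> is four times \<open>q\<close>.\<close>
  define z where "z = 1 + ((x - 1) * m * g + (x - 1) * m * g)"
  define f where "f = (1 / 2) *\<^sub>R (1 + m * h)"
  have f2: "f + f = 1 + m * h"
    by (simp add: f_def flip: scaleR_2)
  have xx: "x * x = x + q" by (simp add: q_def)
  have assoc: "x * (x * t) = x * t + q * t" "x * (q * t) = q * (x * t)"
    "g * (x * t) = x * (g * t)" "g * (q * t) = q * (g * t)" for t
    using xx qx gx gq by (metis distrib_right mult.assoc)+
  note norm = xx qx gx gq assoc mult.assoc left_diff_distrib right_diff_distrib
    distrib_left distrib_right
  have hm: "h * m = m * h" and hx: "h * x = x * h"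
    by (simp_all add: g m_def w_def norm)
  have "h * h * (1 + w) = 1"
    by (simp add: h_def binomial_series_mult w binomial_series_0 flip: binomial_series_1)
  moreover have "m * m = 1 + w"
    by (simp add: m_def w_def norm)
  moreover have "(m * h) * (m * h) = m * m * (h * h)"
    by (metis hm mult.assoc)
  moreover have "m * m * (h * h) = (h * h) * (m * m)"
    by (metis hm mult.assoc)
  ultimately have mh: "(m * h) * (m * h) = 1" by simp
  have "f * (f + f) + f * (f + f) = (f + f) + (f + f)"
  proof -
    have "f * (f + f) + f * (f + f) = (f + f) * (f + f)" by (simp add: distrib_right)
    also have "\<dots> = (f + f) + (f + f)"
      unfolding f2 by (simp add: distrib_left distrib_right mh)
    finally show ?thesis .
  qed
  from double_eqD[OF this] have "f * f + f * f = f + f" by (simp add: distrib_left)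
  then have ff: "f * f = f" by (rule double_eqD)
  have "f * x + f * x = (f + f) * x" by (simp add: distrib_right)
  also have "\<dots> = x * (f + f)" by (simp add: f2 g w_def m_def norm)
  also have "\<dots> = x * f + x * f" by (simp add: distrib_left)
  finally have fx: "f * x = x * f" by (rule double_eqD)
  \<comment> \<open>The part of \<open>x\<close> belonging to \<open>1 - f\<close> is a multiple of
    \<open>q\<close>: here \<open>x * (1 - m)\<close> is minus twice \<open>q\<close>, and the rest
    contains the factor \<open>w\<close>.\<close>
  have "x - x * f + (x - x * f) = (x + x) - x * (f + f)" by (simp add: distrib_left)
  also have "\<dots> = q * (- 1 - (x * m * g + x * m * g)) + q * (- 1 - (x * m * g + x * m * g))"
    by (simp add: f2 g w_def m_def norm)
  finally have xf: "x - x * f = q * (- 1 - (x * m * g + x * m * g))" by (rule double_eqD)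
  have xf_q: "x - x * f \<in> quasinilpotents"
    unfolding xf by (rule quasinilpotents_mult_commute[OF q]) (simp add: m_def norm)
  have "x * f - f + (x * f - f) = x * (f + f) - (f + f)"
    by (simp add: distrib_left)
  also have "\<dots> = q * z + q * z"
    by (simp add: f2 g w_def m_def z_def norm)
  finally have qz: "x * f - f = q * z" by (rule double_eqD)
  have qz_q: "q * z \<in> quasinilpotents"
    by (rule quasinilpotents_mult_commute[OF q]) (simp add: z_def m_def norm)
  \<comment> \<open>This is the inverse of \<open>1 + q * z\<close>. Since
    \<open>x * f = f * (1 + q * z)\<close>, the element \<open>f * k\<close> inverts
    \<open>x\<close> on the part belonging to \<open>f\<close>.\<close>
  define k where "k = binomial_series (- 1) (q * z)"
  have kqz: "(1 + q * z) * k = 1"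
    by (simp add: k_def binomial_series_mult qz_q binomial_series_0 flip: binomial_series_1)
  have ffx: "f * (f * t) = f * t" "f * (x * t) = x * (f * t)" for t
    using ff fx by (metis mult.assoc)+
  have kx: "k * x = x * k" and kf: "k * f = f * k"
    unfolding k_def
    by (rule binomial_series_commute[OF qz_q];
        simp add: ff fx ffx mult.assoc left_diff_distrib right_diff_distrib flip: qz)+
  have "x * (f * k) = (f + (x * f - f)) * k" by (simp add: mult.assoc)
  also have "\<dots> = f * (1 + q * z) * k"
    by (simp add: distrib_left right_diff_distrib ff fx ffx flip: qz)
  also have "\<dots> = f" using kqz by (simp add: mult.assoc)
  finally have xfk: "x * (f * k) = f" .
  show ?thesis
  proof (rule gDrazin_invertiblesI[where y = "f * k"])
    have fkx: "f * k * x = f" using xfk kx fx by (metis mult.assoc)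
    then show "x * (f * k) = f * k * x" using xfk by simp
    show "f * k = f * k * x * (f * k)" unfolding fkx using ff by (simp flip: mult.assoc)
    show "x - x * (x * (f * k)) \<in> quasinilpotents" unfolding xfk by (rule xf_q)
  qed
qed

text \<open>The idempotent \<open>f = n * d\<close> commutes with \<open>x\<close> and splits it
  into orthogonal summands. For \<open>x - x * f\<close> the difference of square and element is
  \<open>n - n * f\<close>, which is quasinilpotent; \<open>x * f\<close> is invertible relative to
  \<open>f\<close>.\<close>

lemma gDrazin_if_square_minus:
  fixes x :: "'a::complex_banach_algebra"
  assumes "x * x - x \<in> gDrazin_invertibles"
  shows "x \<in> gDrazin_invertibles"
proof -
  define n where "n = x * x - x"
  obtain d where d: "n * d = d * n" "d * (n * d) = d" "n - n * (n * d) \<in> quasinilpotents"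
    using gDrazin_invertiblesE assms unfolding n_def by blast
  have nx: "n * x = x * n" by (simp add: n_def algebra_simps)
  have dx: "d * x = x * d" by (rule gDrazin_double_commutant[OF d nx])
  define f where "f = n * d"
  have fx: "f * x = x * f" unfolding f_def by (metis dx nx mult.assoc)
  have fd: "f * d = d" "d * f = d" using d(1,2) by (simp_all add: f_def) (metis mult.assoc)
  have ff: "f * f = f" unfolding f_def using d(2) by (simp add: mult.assoc)
  have assoc: "f * (x * t) = x * (f * t)" "f * (f * t) = f * t" "f * (d * t) = d * t"
    "d * (x * t) = x * (d * t)" "d * (f * t) = d * t" for t
    using fx fd ff dx by (metis mult.assoc)+
  note norm = fx fd ff dx assoc mult.assoc left_diff_distrib right_diff_distrib
  have "(x - x * f) * (x - x * f) - (x - x * f) = n - n * f"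
    by (simp add: norm n_def)
  then have "x - x * f \<in> gDrazin_invertibles"
    using d(3) by (intro gDrazin_if_square_minus_quasinilpotent) (simp add: f_def)
  moreover have "x * f \<in> gDrazin_invertibles"
  \<comment> \<open>The witness comes from factoring \<open>n = x * (x - 1)\<close>: then
    \<open>x * ((x - 1) * d) = n * d = f\<close>.\<close>
  proof (rule gDrazin_invertiblesI[where y = "x * d - d"])
    have xxd: "x * (x * d) - x * d = f"
      by (simp add: f_def n_def left_diff_distrib mult.assoc)
    then have 1: "x * f * (x * d - d) = f" by (simp add: norm)
    from xxd have 2: "(x * d - d) * (x * f) = f" by (simp add: norm)
    show "x * f * (x * d - d) = (x * d - d) * (x * f)" using 1 2 by simp
    show "x * d - d = (x * d - d) * (x * f) * (x * d - d)"
      unfolding 2 by (simp add: norm)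
    show "x * f - x * f * (x * f * (x * d - d)) \<in> quasinilpotents"
      unfolding 1 by (simp add: norm quasinilpotents_zero)
  qed
  ultimately have "x - x * f + x * f \<in> gDrazin_invertibles"
    by (rule gDrazin_add_orthogonal) (simp_all add: norm)
  then show ?thesis by simp
qed

section \<open>Two-by-two matrices\<close>

lemma mat2_minus: "- mat2 a b c d = mat2 (- a) (- b) (- c) (- d)"
  by transfer (simp add: vec_eq_iff forall_2)

lemma mat2_diff: "mat2 a b c d - mat2 a' b' c' d' = mat2 (a - a') (b - b') (c - c') (d - d')"
  by transfer (simp add: vec_eq_iff forall_2)

lemma mat2_mult:
  "mat2 a b c d * mat2 a' b' c' d'
    = mat2 (a * a' + b * c') (a * b' + b * d') (c * a' + d * c') (c * b' + d * d')"
  by transfer (simp add: vec_eq_iff forall_2 sum_2)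

lemma mat2_1: "1 = mat2 1 0 0 1"
  by transfer (simp add: vec_eq_iff forall_2 mat_def)

lemma mat2_eq_iff: "mat2 a b c d = mat2 a' b' c' d' \<longleftrightarrow> a = a' \<and> b = b' \<and> c = c' \<and> d = d'"
  by transfer (auto simp: vec_eq_iff forall_2)

lemma mat2_exhaust:
  obtains a b c d where "X = mat2 a b c d"
proof -
  have "\<exists>a b c d. X = mat2 a b c d"
  proof (transfer, intro exI)
    fix X :: "'a ^ 2 ^ 2"
    show "X = vector [vector [X $ 1 $ 1, X $ 1 $ 2], vector [X $ 2 $ 1, X $ 2 $ 2]]"
      by (simp add: vec_eq_iff forall_2)
  qed
  then show thesis using that by blast
qed

section \<open>Scalar diagonal matrices\<close>

lemma norm_mat2_diag: "norm (mat2 a 0 0 a) = sqrt 2 * norm a"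
  by transfer (simp add: norm_vec_def L2_set_def sum_2 real_sqrt_mult)

lemma mat2_diag_power: "mat2 a 0 0 a ^ n = mat2 (a ^ n) 0 0 (a ^ n)"
  by (induction n) (simp_all add: mat2_1 mat2_mult)

lemma quasinilpotents_mat2_diag_iff:
  "mat2 a 0 0 a \<in> quasinilpotents \<longleftrightarrow> a \<in> quasinilpotents"
proof
  assume *: "mat2 a 0 0 a \<in> quasinilpotents"
  have le: "norm (a ^ n) \<le> norm (mat2 a 0 0 a ^ n)" for n
    using mult_right_mono[of 1 "sqrt 2" "norm (a ^ n)"]
    by (simp add: mat2_diag_power norm_mat2_diag)
  have "\<forall>\<^sub>F n in sequentially. norm (a ^ n) \<le> e ^ n"
    if "\<forall>\<^sub>F n in sequentially. norm (mat2 a 0 0 a ^ n) \<le> e ^ n" for e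
    using that
  proof eventually_elim
    case (elim n)
    with le show ?case by (rule order_trans)
  qed
  then show "a \<in> quasinilpotents"
    using * by (simp add: quasinilpotents_iff)
next
  assume a: "a \<in> quasinilpotents"
  show "mat2 a 0 0 a \<in> quasinilpotents"
  proof (rule quasinilpotents_bound[OF a])
    fix n
    show "norm (mat2 a 0 0 a ^ Suc n) \<le> sqrt 2 * norm a * norm (a ^ n)"
      using mult_left_mono[OF norm_mult_ineq[of a "a ^ n"], of "sqrt 2"]
      by (simp only: mat2_diag_power norm_mat2_diag power_Suc[of a] mult.assoc) simp
  qed
qed

text \<open>The matrix commutes with the off-diagonal matrix units, hence so does any g-Drazin
  inverse of it by the double commutant property. This forces the inverse to be
  \<open>mat2 y 0 0 y\<close>.\<close>

lemma gDrazin_mat2_diag_iff: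
  "mat2 a 0 0 a \<in> gDrazin_invertibles \<longleftrightarrow> a \<in> gDrazin_invertibles"
proof
  assume "mat2 a 0 0 a \<in> gDrazin_invertibles"
  then obtain Y where Y: "mat2 a 0 0 a * Y = Y * mat2 a 0 0 a" "Y * (mat2 a 0 0 a * Y) = Y"
    "mat2 a 0 0 a - mat2 a 0 0 a * (mat2 a 0 0 a * Y) \<in> quasinilpotents"
    by (rule gDrazin_invertiblesE)
  obtain y u v w where Ye: "Y = mat2 y u v w" by (rule mat2_exhaust)
  have "Y * mat2 0 1 0 0 = mat2 0 1 0 0 * Y" "Y * mat2 0 0 1 0 = mat2 0 0 1 0 * Y"
    by (rule gDrazin_double_commutant[OF Y]; simp add: mat2_mult)+
  then have "u = 0" "v = 0" "w = y"
    by (simp_all add: Ye mat2_mult mat2_eq_iff)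
  with Y Ye show "a \<in> gDrazin_invertibles"
    by (intro gDrazin_invertiblesI[where y = y])
      (simp_all add: mat2_mult mat2_diff mat2_eq_iff mult.assoc quasinilpotents_mat2_diag_iff)
next
  assume "a \<in> gDrazin_invertibles"
  then obtain y where "a * y = y * a" "y * (a * y) = y" "a - a * (a * y) \<in> quasinilpotents"
    by (rule gDrazin_invertiblesE)
  then show "mat2 a 0 0 a \<in> gDrazin_invertibles"
    by (intro gDrazin_invertiblesI[where y = "mat2 y 0 0 y"])
      (simp_all add: mat2_mult mat2_diff mat2_eq_iff mult.assoc quasinilpotents_mat2_diag_iff)
qed

section \<open>Reduction of the given matrix to a scalar diagonal one\<close>

lemma gDrazin_cline_iff: "x * y \<in> gDrazin_invertibles \<longleftrightarrow> y * x \<in> gDrazin_invertibles"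
  using gDrazin_cline by blast

theorem theorem3p3:
  fixes a b c :: "'a::complex_banach_algebra"
  assumes "a\<^sup>2 = a" and "a * b = b"
  shows "mat2 a b c 0 \<in> gDrazin_invertibles \<longleftrightarrow> b * c \<in> gDrazin_invertibles"
proof -
  define t where "t = b * (c * a)"
  define K where "K = mat2 a t a 0"
  define R :: "'a mat2" where "R = mat2 1 (- 1) 0 (- 1)"
  have aa: "a * a = a" "a * (a * x) = a * x" for x
    using assms(1) by (metis power2_eq_square mult.assoc)+
  have ab: "a * (b * x) = b * x" for x
    using assms(2) by (metis mult.assoc)
  have at: "a * t = t" "t * a = t"
    by (simp_all add: t_def ab aa mult.assoc)
  \<comment> \<open>Three factorizations are reversed in turn: the first collects \<open>b\<close>
    and \<open>c\<close> in one entry, the second turns the lower left 1 into \<open>a\<close>, the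
    third puts \<open>a\<close> to the right of \<open>b * c\<close>.\<close>
  have "mat2 a b c 0 = mat2 1 0 0 c * mat2 a b 1 0"
    by (simp add: mat2_mult)
  also have "\<dots> \<in> gDrazin_invertibles \<longleftrightarrow> mat2 a b 1 0 * mat2 1 0 0 c \<in> gDrazin_invertibles"
    by (rule gDrazin_cline_iff)
  also have "mat2 a b 1 0 * mat2 1 0 0 c = mat2 a 0 0 1 * mat2 a (b * c) 1 0"
    by (simp add: mat2_mult aa ab)
  also have "\<dots> \<in> gDrazin_invertibles \<longleftrightarrow>
      mat2 a (b * c) 1 0 * mat2 a 0 0 1 \<in> gDrazin_invertibles"
    by (rule gDrazin_cline_iff)
  also have "mat2 a (b * c) 1 0 * mat2 a 0 0 1 = mat2 1 0 0 a * mat2 a (b * c) a 0"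
    by (simp add: mat2_mult aa)
  also have "\<dots> \<in> gDrazin_invertibles \<longleftrightarrow>
      mat2 a (b * c) a 0 * mat2 1 0 0 a \<in> gDrazin_invertibles"
    by (rule gDrazin_cline_iff)
  also have "mat2 a (b * c) a 0 * mat2 1 0 0 a = K"
    by (simp add: mat2_mult K_def t_def mult.assoc)
  finally have MK: "mat2 a b c 0 \<in> gDrazin_invertibles \<longleftrightarrow> K \<in> gDrazin_invertibles" .
  have KK: "K * K - K = mat2 t 0 0 t"
    by (simp add: K_def mat2_mult mat2_diff aa at)
  have RR: "R * R = 1" by (simp add: R_def mat2_mult mat2_1)
  \<comment> \<open>Both orders are computed because the product rule also requires \<open>K\<close>
    and \<open>R * K * R\<close> to commute.\<close>
  have KJ: "K * (R * K * R) = - mat2 t 0 0 t" "R * K * R * K = - mat2 t 0 0 t"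
    by (simp_all add: K_def R_def mat2_mult mat2_minus aa at)
  have "K \<in> gDrazin_invertibles \<longleftrightarrow> mat2 t 0 0 t \<in> gDrazin_invertibles"
  proof
    assume K: "K \<in> gDrazin_invertibles"
    \<comment> \<open>As \<open>R\<close> is an involution, passing to the conjugate
      \<open>R * K * R\<close> is Cline's formula for the factors \<open>K * R\<close> and
      \<open>R\<close>.\<close>
    then have "K * R * R \<in> gDrazin_invertibles" by (simp add: RR mult.assoc)
    then have "R * (K * R) \<in> gDrazin_invertibles" by (rule gDrazin_cline)
    then have "K * (R * K * R) \<in> gDrazin_invertibles"
      using K KJ by (intro gDrazin_mult_commute[of K "R * K * R"]) (simp_all add: mult.assoc)
    then show "mat2 t 0 0 t \<in> gDrazin_invertibles"
      using gDrazin_minus KJ by fastforce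
  next
    assume "mat2 t 0 0 t \<in> gDrazin_invertibles"
    then show "K \<in> gDrazin_invertibles"
      using gDrazin_if_square_minus[of K] by (simp only: KK)
  qed
  moreover have "t \<in> gDrazin_invertibles \<longleftrightarrow> b * c \<in> gDrazin_invertibles"
    using gDrazin_cline_iff[of "b * c" a] by (simp add: t_def mult.assoc ab)
  ultimately show ?thesis using MK gDrazin_mat2_diag_iff by blast
qed

end
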